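(* Let $T$ be a square of side length $h>0$ with sides parallel to the coordinate axes and vertices $\mathbf{x}_1$ (lower left), $\mathbf{x}_2=\mathbf{x}_1+h\langle 1,0\rangle$, $\mathbf{x}_3=\mathbf{x}_1+h\langle 1,1\rangle$, $\mathbf{x}_4=\mathbf{x}_1+h\langle 0,1\rangle$. Let $$V_5(T)=\mathrm{span}\{P_5(T),\ b_1^{1,0},\ b_1^{2,0},\ b_1^{3,0},\ b_3^{1,0},\ b_2^{1,0},\ b_3^{2,0},\ b_4^{1,0}\},$$ where the $b_\ell^{i,j}$ are the nodal basis functions of the $C^1$-$Q_5$ Bell element defined in the context. Then the following 28 degrees of freedom uniquely determine the functions $p\in V_5(T)$ (that is, for every prescription of real values for these functionals there is exactly one $p\in V_5(T)$ attaining them): $$p(\mathbf{x}_i),\ \partial_x p(\mathbf{x}_i),\ \partial_y p(\mathbf{x}_i),\ \partial_{xy}p(\mathbf{x}_i),\quad i=1,2,3,4,$$ $$p\Big(\frac{j\mathbf{x}_1+(3-j)\mathbf{x}_2}{3}\Big),\ p\Big(\frac{j\mathbf{x}_2+(3-j)\mathbf{x}_3}{3}\Big),\ p\Big(\frac{j\mathbf{x}_4+(3-j)\mathbf{x}_3}{3}\Big),\ p\Big(\frac{j\mathbf{x}_1+(3-j)\mathbf{x}_4}{3}\Big),\quad j=1,2,$$ $$\partial_y p\Big(\frac{\mathbf{x}_4+\mathbf{x}_3}{2}\Big),\quad \partial_y p\Big(\frac{\mathbf{x}_1+\mathbf{x}_2}{2}\Big),\quad \partial_x p\Big(\frac{\mathbf{x}_2+\mathbf{x}_3}{2}\Big),\quad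 \partial_x p\Big(\frac{\mathbf{x}_1+\mathbf{x}_4}{2}\Big).$$
   Context: $P_k(T)$ denotes the polynomials in $(x,y)$ of total degree at most $k$ restricted to $T$, and $Q_k=\mathrm{span}\{x^{k_1}y^{k_2}: 0\le k_1,k_2\le k\}$. On an edge $e$, $Q_{k-1}(e)$ is the space of univariate polynomials of degree at most $k-1$ on $e$, and $\partial_{\mathbf n}$ is the normal derivative on $e$. The $C^1$-$Q_5$ Bell element space on $T$ is $W_5(T)=\{v\in Q_5(T): \partial_{\mathbf n}v|_e\in Q_4(e) \text{ for each edge } e \text{ of } T\}$. Its (known unisolvent) 32 degrees of freedom are: (1) $v$ at $\mathbf{x}_1+\frac h3\langle i,j\rangle$, $i,j=0,1,2,3$; (2) $\partial_x v$ at $\mathbf{x}_1+h\langle i,\frac j2\rangle$, $i=0,1$, $j=0,1,2$; (3) $\partial_y v$ at $\mathbf{x}_1+h\langle \frac i2,j\rangle$, $i=0,1,2$, $j=0,1$; (4) $\partial_{xy}v$ at $\mathbf{x}_1+h\langle i,j\rangle$, $i,j=0,1$. The nodal basis of $W_5(T)$ dual to these degrees of freedom is denoted $b_1^{i,j}$, $b_2^{i,j}$, $b_3^{i,j}$, $b_4^{i,j}$, where $b_\ell^{i,j}\in W_5(T)$ takes value $1$ on the degree of freedom of type $(\ell)$ with index $(i,j)$ and $0$ on all other degrees of freedom in the list. *)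

theory Defs
  imports
    "HOL-Analysis.Analysis"
    "HOL-Computational_Algebra.Polynomial"
    "HOL-Library.Function_Algebras"
begin

(* The spaces on T consist of polynomial functions on the whole plane rather than of their
   restrictions to T. As T has nonempty interior, restriction to T is injective on them, and
   partial derivatives at boundary points of T then need no one-sided convention. *)

interpretation fun_space: vector_space "\<lambda>(c::real) (f :: real \<times> real \<Rightarrow> real) z. c * f z"
  by unfold_locales (auto simp: fun_eq_iff algebra_simps)

definition mono_xy :: "nat \<Rightarrow> nat \<Rightarrow> real \<times> real \<Rightarrow> real" where
  "mono_xy i j = (\<lambda>(x, y). x ^ i * y ^ j)"

definition P_space :: "nat \<Rightarrow> (real \<times> real \<Rightarrow> real) set" where
  "P_space k = fun_space.span {mono_xy i j | i j. i + j \<le> k}"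

definition Q_space :: "nat \<Rightarrow> (real \<times> real \<Rightarrow> real) set" where
  "Q_space k = fun_space.span {mono_xy i j | i j. i \<le> k \<and> j \<le> k}"

definition dir_deriv :: "real \<times> real \<Rightarrow> (real \<times> real \<Rightarrow> real) \<Rightarrow> real \<times> real \<Rightarrow> real" where
  "dir_deriv n f z = frechet_derivative f (at z) n"

abbreviation "d_x \<equiv> dir_deriv (1, 0)"
abbreviation "d_y \<equiv> dir_deriv (0, 1)"
abbreviation "d_xy f \<equiv> d_y (d_x f)"

(* Functions whose values on the edge with endpoints a and b are a univariate polynomial of
   degree at most k in the affine edge parameter. *)
definition edge_Q :: "nat \<Rightarrow> real \<times> real \<Rightarrow> real \<times> real \<Rightarrow> (real \<times> real \<Rightarrow> real) set" where
  "edge_Q k a b = {g. \<exists>q :: real poly. degree q \<le> k \<and>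
     (\<forall>t\<in>{0..1}. g (a + t *\<^sub>R (b - a)) = poly q t)}"

(* Each edge of the square with lower left vertex x1 and side h, given by its two endpoints
   together with its outward unit normal. *)
definition square_edges ::
    "real \<times> real \<Rightarrow> real \<Rightarrow> ((real \<times> real) \<times> (real \<times> real) \<times> (real \<times> real)) set" where
  "square_edges x1 h =
    {(x1,               x1 + h *\<^sub>R (1, 0), (0, -1)),
     (x1 + h *\<^sub>R (1, 0), x1 + h *\<^sub>R (1, 1), (1, 0)),
     (x1 + h *\<^sub>R (0, 1), x1 + h *\<^sub>R (1, 1), (0, 1)),
     (x1,               x1 + h *\<^sub>R (0, 1), (-1, 0))}"

definition W5 :: "real \<times> real \<Rightarrow> real \<Rightarrow> (real \<times> real \<Rightarrow> real) set" where
  "W5 x1 h = {v \<in> Q_space 5. \<forall>(a, b, n) \<in> square_edges x1 h. dir_deriv n v \<in> edge_Q 4 a b}"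

(* A degree of freedom of W5 is labelled by a triple (l, i, j): l is its type and (i, j) the
   index of its node. *)
definition bell_index :: "(nat \<times> nat \<times> nat) set" where
  "bell_index = {1} \<times> {0..3} \<times> {0..3} \<union> {2} \<times> {0..1} \<times> {0..2} \<union>
     {3} \<times> {0..2} \<times> {0..1} \<union> {4} \<times> {0..1} \<times> {0..1}"

definition bell_dof ::
    "real \<times> real \<Rightarrow> real \<Rightarrow> nat \<times> nat \<times> nat \<Rightarrow> (real \<times> real \<Rightarrow> real) \<Rightarrow> real" where
  "bell_dof x1 h = (\<lambda>(l, i, j) v.
     if l = 1 then v (x1 + (h / 3) *\<^sub>R (real i, real j))
     else if l = 2 then d_x v (x1 + h *\<^sub>R (real i, real j / 2))
     else if l = 3 then d_y v (x1 + h *\<^sub>R (real i / 2, real j))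
     else d_xy v (x1 + h *\<^sub>R (real i, real j)))"

(* The description is proper because the 32 functionals are unisolvent on W5. *)
definition bell_basis ::
    "real \<times> real \<Rightarrow> real \<Rightarrow> nat \<Rightarrow> nat \<Rightarrow> nat \<Rightarrow> real \<times> real \<Rightarrow> real" where
  "bell_basis x1 h l i j = (THE b. b \<in> W5 x1 h \<and>
     (\<forall>d\<in>bell_index. bell_dof x1 h d b = (if d = (l, i, j) then 1 else 0)))"

definition V5 :: "real \<times> real \<Rightarrow> real \<Rightarrow> (real \<times> real \<Rightarrow> real) set" where
  "V5 x1 h = fun_space.span (P_space 5 \<union>
     {bell_basis x1 h 1 1 0, bell_basis x1 h 1 2 0, bell_basis x1 h 1 3 0,
      bell_basis x1 h 3 1 0, bell_basis x1 h 2 1 0, bell_basis x1 h 3 2 0,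
      bell_basis x1 h 4 1 0})"

definition V5_dofs ::
    "real \<times> real \<Rightarrow> real \<times> real \<Rightarrow> real \<times> real \<Rightarrow> real \<times> real \<Rightarrow>
     ((real \<times> real \<Rightarrow> real) \<Rightarrow> real) list" where
  "V5_dofs x1 x2 x3 x4 =
    [\<lambda>p. p x1, \<lambda>p. p x2, \<lambda>p. p x3, \<lambda>p. p x4,
     \<lambda>p. d_x p x1, \<lambda>p. d_x p x2, \<lambda>p. d_x p x3, \<lambda>p. d_x p x4,
     \<lambda>p. d_y p x1, \<lambda>p. d_y p x2, \<lambda>p. d_y p x3, \<lambda>p. d_y p x4,
     \<lambda>p. d_xy p x1, \<lambda>p. d_xy p x2, \<lambda>p. d_xy p x3, \<lambda>p. d_xy p x4,
     \<lambda>p. p ((1 *\<^sub>R x1 + 2 *\<^sub>R x2) /\<^sub>R 3), \<lambda>p. p ((2 *\<^sub>R x1 + 1 *\<^sub>R x2) /\<^sub>R 3),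
     \<lambda>p. p ((1 *\<^sub>R x2 + 2 *\<^sub>R x3) /\<^sub>R 3), \<lambda>p. p ((2 *\<^sub>R x2 + 1 *\<^sub>R x3) /\<^sub>R 3),
     \<lambda>p. p ((1 *\<^sub>R x4 + 2 *\<^sub>R x3) /\<^sub>R 3), \<lambda>p. p ((2 *\<^sub>R x4 + 1 *\<^sub>R x3) /\<^sub>R 3),
     \<lambda>p. p ((1 *\<^sub>R x1 + 2 *\<^sub>R x4) /\<^sub>R 3), \<lambda>p. p ((2 *\<^sub>R x1 + 1 *\<^sub>R x4) /\<^sub>R 3),
     \<lambda>p. d_y p ((x4 + x3) /\<^sub>R 2), \<lambda>p. d_y p ((x1 + x2) /\<^sub>R 2),
     \<lambda>p. d_x p ((x2 + x3) /\<^sub>R 2), \<lambda>p. d_x p ((x1 + x4) /\<^sub>R 2)]"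

end

theory Submission
  imports Defs
begin

text \<open>
  The 28 functionals are the degrees of freedom of the Bell element other than its four interior
  values, that is, those with an index in \<open>bell_index - interior_index\<close>. Seven of them belong to
  the added basis functions, and duality makes the system triangular: each added function is seen by
  its own functional and by none of the other 27. Everything therefore reduces to one claim: a polynomial of total degree at most 5 is determined by the 21 functionals
  that are left (\<open>P5_coefficients_eq_0\<close>).

  In coordinates \<open>s\<close>, \<open>t\<close> that map the square to the unit square, let \<open>p\<close> of degree at most 5 have
  all 21 functionals zero. No functional is missing on the left edge and on the top edge. On such an
  edge \<open>p\<close> is a quintic with two double zeros and two simple ones, so it vanishes; its normal
  derivative is a quartic with two double zeros and a simple one, so it vanishes too. Hence
  \<open>p = s\<^sup>2 (1 - t)\<^sup>2 (A + B s + C t)\<close>. The two remaining values on the right edge make the linear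
  factor vanish there, so it is a multiple of \<open>1 - s\<close>, and the normal derivative at the midpoint of
  that edge makes this multiple zero. As \<open>P\<^sub>5\<close> has dimension 21, interpolation exists as well
  (\<open>square_system_solvable\<close>).

  The basis functions are given by a definite description, so the argument also rests on the
  unisolvence of the Bell element itself (\<open>bell_unisolvent\<close>). It is again a square system: 36
  coefficients of a biquintic against 32 degrees of freedom and four conditions that lower the degree
  of the normal derivative on the edges. In the kernel, the normal derivative vanishes on
  all four edges; then the restrictions to the lines \<open>s = 0, 1/3, 2/3, 1\<close> vanish as quintics in \<open>t\<close>;
  and finally, for each power of \<open>t\<close>, its coefficient is a quintic in \<open>s\<close> that has zeros at these
  four points, double ones at both ends (\<open>bell_coefficients_eq_0\<close>).

  All this is done on coefficient families with respect to \<open>s\<^sup>p t\<^sup>q\<close>. The affine change of coordinates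
  preserves both polynomial spaces (\<open>span_mono_xy\<close>), and it multiplies each functional by a power of
  \<open>h\<close> (\<open>bell_dof_pull_back\<close>).
\<close>

section \<open>Finite linear algebra\<close>

lemma (in vector_space) span_image_finite:
  assumes "finite M"
  shows "span (b ` M) = range (\<lambda>k. \<Sum>m\<in>M. scale (k m) (b m))"
proof
  have "subspace (range (\<lambda>k. \<Sum>m\<in>M. scale (k m) (b m)))"
  proof (rule subspaceI)
    show "0 \<in> range (\<lambda>k. \<Sum>m\<in>M. scale (k m) (b m))"
      by (rule range_eqI[of _ _ "\<lambda>_. 0"]) simp
  next
    fix x y
    assume "x \<in> range (\<lambda>k. \<Sum>m\<in>M. scale (k m) (b m))" "y \<in> range (\<lambda>k. \<Sum>m\<in>M. scale (k m) (b m))"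
    then obtain k l where "x = (\<Sum>m\<in>M. scale (k m) (b m))" "y = (\<Sum>m\<in>M. scale (l m) (b m))"
      by blast
    then have "x + y = (\<Sum>m\<in>M. scale (k m + l m) (b m))"
      by (simp add: sum.distrib scale_left_distrib)
    then show "x + y \<in> range (\<lambda>k. \<Sum>m\<in>M. scale (k m) (b m))"
      by (rule range_eqI[where x = "\<lambda>m. k m + l m"])
  next
    fix r x
    assume "x \<in> range (\<lambda>k. \<Sum>m\<in>M. scale (k m) (b m))"
    then obtain k where "x = (\<Sum>m\<in>M. scale (k m) (b m))"
      by blast
    then have "scale r x = (\<Sum>m\<in>M. scale (r * k m) (b m))"
      by (simp add: scale_sum_right)
    then show "scale r x \<in> range (\<lambda>k. \<Sum>m\<in>M. scale (k m) (b m))"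
      by (rule range_eqI[where x = "\<lambda>m. r * k m"])
  qed
  moreover have "b ` M \<subseteq> range (\<lambda>k. \<Sum>m\<in>M. scale (k m) (b m))"
  proof
    fix x
    assume "x \<in> b ` M"
    then obtain n where "n \<in> M" "x = b n"
      by blast
    with assms have "x = (\<Sum>m\<in>M. scale (if m = n then 1 else 0) (b m))"
      by (simp add: if_distrib[of "\<lambda>r. scale r _"] sum.delta cong: if_cong)
    then show "x \<in> range (\<lambda>k. \<Sum>m\<in>M. scale (k m) (b m))"
      by (rule range_eqI[where x = "\<lambda>m. if m = n then 1 else 0"])
  qed
  ultimately show "span (b ` M) \<subseteq> range (\<lambda>k. \<Sum>m\<in>M. scale (k m) (b m))"
    by (rule span_minimal[rotated])
  show "range (\<lambda>k. \<Sum>m\<in>M. scale (k m) (b m)) \<subseteq> span (b ` M)"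
    by (auto intro!: span_sum span_scale intro: span_base)
qed

lemma sum_fun_apply: "(\<Sum>i\<in>I. f i) x = (\<Sum>i\<in>I. f i x :: 'b :: comm_monoid_add)"
  by (induction I rule: infinite_finite_induct) auto

text \<open>
  The rows of \<open>A\<close> are independent. They span every right-hand side, since one outside their span
  would extend them to \<open>card J + 1\<close> independent vectors in a space spanned by \<open>card J\<close> unit vectors.
\<close>
lemma square_system_solvable:
  fixes A :: "'i \<Rightarrow> 'j \<Rightarrow> real"
  assumes "finite I" "finite J" and card: "card I = card J"
    and inj: "\<And>c i. (\<And>j. j \<in> J \<Longrightarrow> (\<Sum>i\<in>I. c i * A i j) = 0) \<Longrightarrow> i \<in> I \<Longrightarrow> c i = 0"
  shows "\<exists>c. \<forall>j\<in>J. (\<Sum>i\<in>I. c i * A i j) = y j"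
proof -
  interpret vs: vector_space "\<lambda>(r::real) (f :: 'j \<Rightarrow> real) z. r * f z"
    by unfold_locales (auto simp: fun_eq_iff algebra_simps)
  define row where "row i = (\<lambda>j. if j \<in> J then A i j else 0)" for i
  define unit where "unit j = (\<lambda>k. if k = j then 1 else 0 :: real)" for j :: 'j
  have supp: "f \<in> vs.span (unit ` J)" if "\<And>j. j \<notin> J \<Longrightarrow> f j = 0" for f
  proof -
    have "f = (\<Sum>j\<in>J. (\<lambda>z. f j * unit j z))"
      using that \<open>finite J\<close>
      by (auto simp: fun_eq_iff sum_fun_apply unit_def if_distrib[of "(*) _"] cong: if_cong)
    also have "\<dots> \<in> vs.span (unit ` J)"
      by (intro vs.span_sum vs.span_scale vs.span_base imageI)
    finally show ?thesis .
  qed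
  have comb: "c i = 0" if "(\<Sum>i\<in>I. (\<lambda>z. c i * row i z)) = 0" "i \<in> I" for c i
  proof (rule inj[OF _ \<open>i \<in> I\<close>])
    fix j
    assume "j \<in> J"
    then show "(\<Sum>i\<in>I. c i * A i j) = 0"
      using fun_cong[OF that(1), of j] by (simp add: sum_fun_apply row_def)
  qed
  have inj_row: "inj_on row I"
  proof (rule inj_onI, rule ccontr)
    fix i i'
    assume *: "i \<in> I" "i' \<in> I" "row i = row i'" "i \<noteq> i'"
    have "(\<Sum>m\<in>I. (\<lambda>z. (if m = i then 1 else if m = i' then -1 else 0) * row m z)) = 0"
    proof -
      have "(if m = i then 1 else if m = i' then -1 else 0) * row m z
          = (if m = i then row i z else 0) - (if m = i' then row i' z else 0)" for m z
        using * by auto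
      then show ?thesis
        using * \<open>finite I\<close> by (auto simp: fun_eq_iff sum_fun_apply sum_subtractf)
    qed
    from comb[OF this \<open>i \<in> I\<close>] show False by simp
  qed
  have indep: "vs.independent (row ` I)"
  proof (rule vs.independent_if_scalars_zero)
    fix u v
    assume *: "(\<Sum>x\<in>row ` I. (\<lambda>z. u x * x z)) = 0" "v \<in> row ` I"
    then show "u v = 0"
      using comb[of "\<lambda>i. u (row i)"] by (auto simp: sum.reindex[OF inj_row])
  qed (use \<open>finite I\<close> in simp)
  let ?y = "\<lambda>j. if j \<in> J then y j else 0"
  have "?y \<in> vs.span (row ` I)"
  proof (rule ccontr)
    assume new: "?y \<notin> vs.span (row ` I)"
    have "insert ?y (row ` I) \<subseteq> vs.span (unit ` J)"
      by (auto intro!: supp simp: row_def)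
    then have "card (insert ?y (row ` I)) \<le> card (unit ` J)"
      using vs.independent_span_bound[OF _ vs.independent_insertI[OF new indep]] \<open>finite J\<close> by simp
    moreover have "card (insert ?y (row ` I)) = Suc (card I)"
      using new vs.span_base[of ?y "row ` I"] \<open>finite I\<close>
      by (subst card_insert_disjoint) (auto simp: card_image inj_row)
    ultimately show False
      using card card_image_le[OF \<open>finite J\<close>, of unit] by simp
  qed
  then obtain c where
      c: "(\<lambda>j. if j \<in> J then y j else 0) = (\<Sum>i\<in>I. (\<lambda>z. c i * row i z))"
    using vs.span_image_finite[OF \<open>finite I\<close>, of row] by blast
  show ?thesis
  proof (intro exI ballI)
    fix j
    assume "j \<in> J"
    then show "(\<Sum>i\<in>I. c i * A i j) = y j"
      using fun_cong[OF c, of j] by (simp add: sum_fun_apply row_def)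
  qed
qed

section \<open>Univariate polynomials\<close>

text \<open>
  The \<open>k\<close>-th derivative of \<open>s\<^sup>p\<close>. Carrying the order as a parameter lets values, first derivatives and
  mixed derivatives be treated by the same statements.
\<close>
definition monom_deriv :: "nat \<Rightarrow> nat \<Rightarrow> real \<Rightarrow> real" where
  "monom_deriv k p s = poly ((pderiv ^^ k) (monom 1 p)) s"

lemma monom_deriv_0: "monom_deriv 0 p s = s ^ p"
  by (simp add: monom_deriv_def poly_monom)

lemma monom_deriv_1: "monom_deriv (Suc 0) p s = real p * s ^ (p - 1)"
  by (simp add: monom_deriv_def pderiv_monom poly_monom)

lemma DERIV_monom_deriv: "(monom_deriv k p has_real_derivative monom_deriv (Suc k) p s) (at s)"
  unfolding monom_deriv_def using poly_DERIV[of "(pderiv ^^ k) (monom 1 p)" s] by simp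

lemma sum_atMost_5: "(\<Sum>q\<le>5. f q) = f 0 + f 1 + f 2 + f 3 + f 4 + f (5::nat)"
  by (simp add: eval_nat_numeral)

lemma atMost_5: "q \<le> 5 \<longleftrightarrow> q = 0 \<or> q = 1 \<or> q = 2 \<or> q = 3 \<or> q = 4 \<or> q = (5::nat)"
  by auto

text \<open>
  A quintic with double zeros at 0 and 1 and simple zeros at 1/3 and 2/3 has six zeros, so it vanishes. The nodes are
  written \<open>m / 3\<close> and \<open>m\<close> to match the nodes of the degrees of freedom.
\<close>
lemma quintic_eq_0:
  fixes a :: "nat \<Rightarrow> real"
  assumes val: "\<And>m. m \<le> 3 \<Longrightarrow> (\<Sum>q\<le>5. a q * monom_deriv 0 q (real m / 3)) = 0"
    and der: "\<And>m. m \<le> 1 \<Longrightarrow> (\<Sum>q\<le>5. a q * monom_deriv 1 q (real m)) = 0"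
    and "q \<le> 5"
  shows "a q = 0"
  using val[of 0] val[of 1] val[of 2] val[of 3] der[of 0] der[of 1] \<open>q \<le> 5\<close>
  by (auto simp: sum_atMost_5 monom_deriv_0 monom_deriv_1 atMost_5 power_divide)

text \<open>
  A quartic with double zeros at 0 and 1 and a simple zero at 1/2 vanishes. It is presented as a
  quintic whose leading coefficient vanishes, because that is how the normal derivatives of
  biquintics arise.
\<close>
lemma quartic_eq_0:
  fixes a :: "nat \<Rightarrow> real"
  assumes val: "\<And>m. m \<le> 2 \<Longrightarrow> (\<Sum>q\<le>5. a q * monom_deriv 0 q (real m / 2)) = 0"
    and der: "\<And>m. m \<le> 1 \<Longrightarrow> (\<Sum>q\<le>5. a q * monom_deriv 1 q (real m)) = 0"
    and "a 5 = 0" "q \<le> 5"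
  shows "a q = 0"
  using val[of 0] val[of 1] val[of 2] der[of 0] der[of 1] \<open>q \<le> 5\<close> \<open>a 5 = 0\<close>
  by (auto simp: sum_atMost_5 monom_deriv_0 monom_deriv_1 atMost_5 power_divide)

text \<open>
  A polynomial is determined by its values on the infinite set \<open>[0, 1]\<close>; membership in an edge
  space of degree 4 thus becomes a condition on one coefficient.
\<close>
lemma quintic_degree_le_4_iff:
  fixes a :: "nat \<Rightarrow> real"
  shows "(\<exists>q. degree q \<le> 4 \<and> (\<forall>t\<in>{0..1}. (\<Sum>j\<le>5. a j * t ^ j) = poly q t)) \<longleftrightarrow> a 5 = 0"
proof
  define f where "f = (\<Sum>j\<le>5. monom (a j) j)"
  have f: "poly f t = (\<Sum>j\<le>5. a j * t ^ j)" for t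
    by (simp add: f_def poly_sum poly_monom)
  have coeff: "coeff f i = (if i \<le> 5 then a i else 0)" for i
    by (simp add: f_def coeff_sum)
  {
    assume "\<exists>q. degree q \<le> 4 \<and> (\<forall>t\<in>{0..1}. (\<Sum>j\<le>5. a j * t ^ j) = poly q t)"
    then obtain q where q: "degree q \<le> 4" "\<And>t. t \<in> {0..1} \<Longrightarrow> poly f t = poly q t"
      unfolding f by blast
    have "f - q = 0"
    proof (rule ccontr)
      assume "f - q \<noteq> 0"
      then have "finite {t. poly (f - q) t = 0}"
        by (rule poly_roots_finite)
      moreover have "{0..1} \<subseteq> {t. poly (f - q) t = 0}"
        using q(2) by auto
      ultimately have "finite {0..1::real}"
        by (rule finite_subset[rotated])
      then show False
        using infinite_Icc[of 0 "1::real"] by simp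
    qed
    then show "a 5 = 0"
      using coeff[of 5] q(1) by (simp add: coeff_eq_0)
  next
    assume "a 5 = 0"
    then have "degree f \<le> 4"
      by (intro degree_le) (auto simp: coeff atMost_5)
    then show "\<exists>q. degree q \<le> 4 \<and> (\<forall>t\<in>{0..1}. (\<Sum>j\<le>5. a j * t ^ j) = poly q t)"
      using f by (intro exI[of _ f]) auto
  }
qed

section \<open>Biquintic polynomials in coordinates attached to the square\<close>

abbreviation grid :: "(nat \<times> nat) set" where "grid \<equiv> {..5} \<times> {..5}"

text \<open>
  The partial derivative of order \<open>(k, l)\<close> of the polynomial with coefficient family \<open>c\<close> on the
  reference square; \<open>ref_deriv 0 0 c\<close> is that polynomial itself.
\<close>
definition ref_deriv :: "nat \<Rightarrow> nat \<Rightarrow> (nat \<times> nat \<Rightarrow> real) \<Rightarrow> real \<Rightarrow> real \<Rightarrow> real" where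
  "ref_deriv k l c s t = (\<Sum>(p, q)\<in>grid. c (p, q) * (monom_deriv k p s * monom_deriv l q t))"

text \<open>
  Composition with the affine map that takes the square to the unit square.
\<close>
definition pull_back :: "real \<times> real \<Rightarrow> real \<Rightarrow> (real \<Rightarrow> real \<Rightarrow> real) \<Rightarrow> real \<times> real \<Rightarrow> real" where
  "pull_back x1 h f = (\<lambda>z. f ((fst z - fst x1) / h) ((snd z - snd x1) / h))"

lemma pull_back_at:
  "h \<noteq> 0 \<Longrightarrow> pull_back x1 h f (x1 + h *\<^sub>R (s, t)) = f s t"
  by (simp add: pull_back_def)

text \<open>
  On a line parallel to an axis a biquintic is a univariate quintic. The next two statements display
  its coefficients on vertical and on horizontal lines, in the form that the lemmas on quintics and
  quartics expect.
\<close>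
lemma ref_deriv_rows: "ref_deriv k l c s t = (\<Sum>q\<le>5. (\<Sum>p\<le>5. c (p, q) * monom_deriv k p s) * monom_deriv l q t)"
  unfolding ref_deriv_def sum.cartesian_product[symmetric]
  by (subst sum.swap) (simp add: sum_distrib_right mult.assoc)

lemma ref_deriv_columns: "ref_deriv k l c s t = (\<Sum>p\<le>5. (\<Sum>q\<le>5. c (p, q) * monom_deriv l q t) * monom_deriv k p s)"
  unfolding ref_deriv_def sum.cartesian_product[symmetric]
  by (simp add: sum_distrib_left sum_distrib_right ac_simps)

lemma ref_deriv_scale: "ref_deriv k l (\<lambda>i. r * c i) s t = r * ref_deriv k l c s t"
  by (simp add: ref_deriv_def sum_distrib_left case_prod_unfold mult.assoc)

lemma ref_deriv_add: "ref_deriv k l (\<lambda>i. c i + c' i) s t = ref_deriv k l c s t + ref_deriv k l c' s t"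
  by (simp add: ref_deriv_def case_prod_unfold sum.distrib distrib_right)

lemma dir_deriv_pull_back:
  assumes "h \<noteq> 0"
  shows "dir_deriv (u, v) (pull_back x1 h (ref_deriv k l c)) =
    pull_back x1 h (\<lambda>s t. (u * ref_deriv (Suc k) l c s t + v * ref_deriv k (Suc l) c s t) / h)"
proof
  fix z :: "real \<times> real"
  let ?S = "\<lambda>z :: real \<times> real. (fst z - fst x1) / h" and ?T = "\<lambda>z :: real \<times> real. (snd z - snd x1) / h"
  have S: "(?S has_derivative (\<lambda>w. fst w / h)) (at z)" 
    by (auto intro!: derivative_eq_intros simp: assms)
  have T: "(?T has_derivative (\<lambda>w. snd w / h)) (at z)"
    by (auto intro!: derivative_eq_intros simp: assms)
  have dS: "((\<lambda>z. monom_deriv k p (?S z)) has_derivative (\<lambda>w. fst w / h * monom_deriv (Suc k) p (?S z))) (at z)" for p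
    by (rule DERIV_compose_FDERIV[OF DERIV_monom_deriv S])
  have dT: "((\<lambda>z. monom_deriv l q (?T z)) has_derivative (\<lambda>w. snd w / h * monom_deriv (Suc l) q (?T z))) (at z)" for q
    by (rule DERIV_compose_FDERIV[OF DERIV_monom_deriv T])
  have "(pull_back x1 h (ref_deriv k l c) has_derivative (\<lambda>w. \<Sum>(p, q)\<in>grid. c (p, q) *
      (monom_deriv k p (?S z) * (snd w / h * monom_deriv (Suc l) q (?T z)) +
       fst w / h * monom_deriv (Suc k) p (?S z) * monom_deriv l q (?T z)))) (at z)"
    unfolding pull_back_def ref_deriv_def case_prod_unfold
    by (intro has_derivative_sum has_derivative_mult_right has_derivative_mult dS dT)
  from frechet_derivative_at[OF this, symmetric]
  show "dir_deriv (u, v) (pull_back x1 h (ref_deriv k l c)) z =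
    pull_back x1 h (\<lambda>s t. (u * ref_deriv (Suc k) l c s t + v * ref_deriv k (Suc l) c s t) / h) z"
    by (simp add: dir_deriv_def pull_back_def ref_deriv_def sum_distrib_left sum.distrib[symmetric]
        sum_divide_distrib case_prod_unfold add_divide_distrib algebra_simps)
qed

lemma d_x_pull_back:
  "h \<noteq> 0 \<Longrightarrow> d_x (pull_back x1 h (ref_deriv k l c)) = pull_back x1 h (ref_deriv (Suc k) l (\<lambda>i. 1 / h * c i))"
  unfolding dir_deriv_pull_back ref_deriv_scale by simp

lemma d_y_pull_back:
  "h \<noteq> 0 \<Longrightarrow> d_y (pull_back x1 h (ref_deriv k l c)) = pull_back x1 h (ref_deriv k (Suc l) (\<lambda>i. 1 / h * c i))"
  unfolding dir_deriv_pull_back ref_deriv_scale by simp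


text \<open>
  The degrees of freedom on the reference square, as functionals of a family \<open>D\<close> of partial
  derivatives indexed by their order. Taking \<open>D\<close> from a coefficient family gives the functional of a
  polynomial, taking it from a single monomial gives a matrix entry.
\<close>
definition ref_dof ::
    "nat \<times> nat \<times> nat \<Rightarrow> (nat \<Rightarrow> nat \<Rightarrow> real \<Rightarrow> real \<Rightarrow> real) \<Rightarrow> real" where
  "ref_dof = (\<lambda>(l, i, j) D.
     if l = 1 then D 0 0 (real i / 3) (real j / 3)
     else if l = 2 then D 1 0 (real i) (real j / 2)
     else if l = 3 then D 0 1 (real i / 2) (real j)
     else D 1 1 (real i) (real j))"

definition dof_order :: "nat \<times> nat \<times> nat \<Rightarrow> nat" where
  "dof_order = (\<lambda>(l, i, j). if l = 1 then 0 else if l = 2 \<or> l = 3 then 1 else 2)"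

lemma bell_dof_pull_back:
  assumes "h \<noteq> 0"
  shows "bell_dof x1 h d (pull_back x1 h (ref_deriv 0 0 c)) =
    ref_dof d (\<lambda>k l. ref_deriv k l c) / h ^ dof_order d"
proof -
  obtain l i j where d: "d = (l, i, j)"
    by (metis prod.exhaust)
  have "x1 + (h / 3) *\<^sub>R (real i, real j) = x1 + h *\<^sub>R (real i / 3, real j / 3)"
    by simp
  then show ?thesis
    unfolding d bell_dof_def ref_dof_def dof_order_def d_x_pull_back[OF assms]
      d_y_pull_back[OF assms] prod.case
    by (simp only: pull_back_at[OF assms] ref_deriv_scale) (simp add: power2_eq_square)
qed

lemma ref_dof_eq_sum:
  "ref_dof d (\<lambda>k l. ref_deriv k l c) =
    (\<Sum>i\<in>grid. c i * ref_dof d (\<lambda>k l s t. monom_deriv k (fst i) s * monom_deriv l (snd i) t))"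
  by (simp add: ref_dof_def ref_deriv_def case_prod_unfold)

lemma ref_dof_diff:
  "ref_dof d (\<lambda>k l. ref_deriv k l (\<lambda>i. c i - c' i)) =
    ref_dof d (\<lambda>k l. ref_deriv k l c) - ref_dof d (\<lambda>k l. ref_deriv k l c')"
  unfolding ref_dof_eq_sum by (simp add: sum_subtractf left_diff_distrib)

text \<open>
  The binomial theorem expands a monomial in the coordinates \<open>X\<close>, \<open>Y\<close> into monomials in \<open>X'\<close>, \<open>Y'\<close>
  with smaller or equal exponents.
\<close>
lemma affine_monomial_in_span:
  fixes X Y X' Y' :: "real \<times> real \<Rightarrow> real"
  assumes X: "\<And>z. X z = \<alpha> + \<beta> * X' z" and Y: "\<And>z. Y z = \<gamma> + \<delta> * Y' z"
    and T: "\<And>k l. k \<le> i \<Longrightarrow> l \<le> j \<Longrightarrow> (k, l) \<in> T"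
  shows "(\<lambda>z. X z ^ i * Y z ^ j) \<in> fun_space.span ((\<lambda>(k, l) z. X' z ^ k * Y' z ^ l) ` T)"
proof -
  have "(\<lambda>z. X z ^ i * Y z ^ j) = (\<Sum>k\<le>i. \<Sum>l\<le>j. (\<lambda>z.
      (of_nat (i choose k) * \<beta> ^ k * \<alpha> ^ (i - k) * (of_nat (j choose l) * \<delta> ^ l * \<gamma> ^ (j - l)))
      * (X' z ^ k * Y' z ^ l)))"
  proof
    fix z
    have "X z ^ i = (\<Sum>k\<le>i. of_nat (i choose k) * (\<beta> * X' z) ^ k * \<alpha> ^ (i - k))"
      unfolding X add.commute[of \<alpha>] by (rule binomial_ring)
    moreover have "Y z ^ j = (\<Sum>l\<le>j. of_nat (j choose l) * (\<delta> * Y' z) ^ l * \<gamma> ^ (j - l))"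
      unfolding Y add.commute[of \<gamma>] by (rule binomial_ring)
    ultimately have "X z ^ i * Y z ^ j = (\<Sum>k\<le>i. \<Sum>l\<le>j.
      (of_nat (i choose k) * (\<beta> * X' z) ^ k * \<alpha> ^ (i - k)) *
      (of_nat (j choose l) * (\<delta> * Y' z) ^ l * \<gamma> ^ (j - l)))"
      by (simp only: sum_product)
    also have "\<dots> = (\<Sum>k\<le>i. \<Sum>l\<le>j.
      (of_nat (i choose k) * \<beta> ^ k * \<alpha> ^ (i - k) * (of_nat (j choose l) * \<delta> ^ l * \<gamma> ^ (j - l)))
      * (X' z ^ k * Y' z ^ l))"
      by (intro sum.cong refl) (simp add: power_mult_distrib)
    finally show "X z ^ i * Y z ^ j = (\<Sum>k\<le>i. \<Sum>l\<le>j. (\<lambda>z.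
      (of_nat (i choose k) * \<beta> ^ k * \<alpha> ^ (i - k) * (of_nat (j choose l) * \<delta> ^ l * \<gamma> ^ (j - l)))
      * (X' z ^ k * Y' z ^ l))) z"
      by (simp only: sum_fun_apply)
  qed
  also have "\<dots> \<in> fun_space.span ((\<lambda>(k, l) z. X' z ^ k * Y' z ^ l) ` T)"
  proof (intro fun_space.span_sum fun_space.span_scale)
    fix k l
    assume "k \<in> {..i}" "l \<in> {..j}"
    then have "(k, l) \<in> T"
      using T by simp
    then show "(\<lambda>z. X' z ^ k * Y' z ^ l) \<in> fun_space.span ((\<lambda>(k, l) z. X' z ^ k * Y' z ^ l) ` T)"
      by (force intro: fun_space.span_base)
  qed
  finally show ?thesis .
qed

text \<open>
  For a downward closed set of exponents, the monomials in \<open>x\<close>, \<open>y\<close> and those in the reference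
  coordinates expand into each other. The triangle for \<open>P\<^sub>5\<close> and the square for \<open>Q\<^sub>5\<close> are both of
  this kind.
\<close>
lemma span_mono_xy:
  assumes "h \<noteq> 0" "T \<subseteq> grid"
    and T: "\<And>i j k l. (i, j) \<in> T \<Longrightarrow> k \<le> i \<Longrightarrow> l \<le> j \<Longrightarrow> (k, l) \<in> T"
  shows "fun_space.span ((\<lambda>(i, j). mono_xy i j) ` T) =
    {pull_back x1 h (ref_deriv 0 0 c) | c. \<forall>i. i \<notin> T \<longrightarrow> c i = 0}"
proof -
  let ?X = "\<lambda>z. (fst z - fst x1) / h" and ?Y = "\<lambda>z. (snd z - snd x1) / h"
  let ?N = "\<lambda>(i, j) z. ?X z ^ i * ?Y z ^ j"
  have mono: "mono_xy i j = (\<lambda>z. fst z ^ i * snd z ^ j)" for i j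
    by (auto simp: mono_xy_def)
  have "fin": "finite T"
    using \<open>T \<subseteq> grid\<close> by (rule finite_subset) simp
  have "fun_space.span ((\<lambda>(i, j). mono_xy i j) ` T) = fun_space.span (?N ` T)"
  proof (rule antisym; rule fun_space.span_minimal[OF _ fun_space.subspace_span])
    have "mono_xy i j \<in> fun_space.span (?N ` T)" if "(i, j) \<in> T" for i j
      unfolding mono using T[OF that] \<open>h \<noteq> 0\<close>
      by (intro affine_monomial_in_span[where \<alpha> = "fst x1" and \<beta> = h and \<gamma> = "snd x1" and \<delta> = h])
        auto
    then show "(\<lambda>(i, j). mono_xy i j) ` T \<subseteq> fun_space.span (?N ` T)"
      by auto
    have "?N (i, j) \<in> fun_space.span ((\<lambda>(i, j). mono_xy i j) ` T)" if "(i, j) \<in> T" for i j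
      unfolding mono prod.case using T[OF that] \<open>h \<noteq> 0\<close>
      by (intro affine_monomial_in_span[where \<alpha> = "- fst x1 / h" and \<beta> = "1 / h"
            and \<gamma> = "- snd x1 / h" and \<delta> = "1 / h"])
        (auto simp: field_simps)
    then show "?N ` T \<subseteq> fun_space.span ((\<lambda>(i, j). mono_xy i j) ` T)"
      by auto
  qed
  also have "\<dots> = range (\<lambda>k. \<Sum>m\<in>T. (\<lambda>z. k m * ?N m z))"
    by (rule fun_space.span_image_finite[OF "fin"])
  also have "\<dots> = {pull_back x1 h (ref_deriv 0 0 c) | c. \<forall>i. i \<notin> T \<longrightarrow> c i = 0}"
  proof -
    have eq: "(\<Sum>m\<in>T. (\<lambda>z. k m * ?N m z)) = pull_back x1 h (ref_deriv 0 0 (\<lambda>i. if i \<in> T then k i else 0))"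
      for k
    proof
      fix z
      have "(\<Sum>m\<in>T. k m * ?N m z) = (\<Sum>m\<in>grid. (if m \<in> T then k m else 0) * ?N m z)"
        using \<open>T \<subseteq> grid\<close> by (intro sum.mono_neutral_cong_left) auto
      also have "\<dots> = (\<Sum>(i, j)\<in>grid. (if (i, j) \<in> T then k (i, j) else 0) * ?N (i, j) z)"
        by (intro sum.cong refl) auto
      finally have "(\<Sum>m\<in>T. k m * ?N m z) =
          (\<Sum>(i, j)\<in>grid. (if (i, j) \<in> T then k (i, j) else 0) * ?N (i, j) z)" .
      then show "(\<Sum>m\<in>T. (\<lambda>z. k m * ?N m z)) z =
          pull_back x1 h (ref_deriv 0 0 (\<lambda>i. if i \<in> T then k i else 0)) z"
        unfolding sum_fun_apply pull_back_def ref_deriv_def monom_deriv_0 prod.case .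
    qed
    show ?thesis
    proof (intro subset_antisym subsetI)
      fix f
      assume "f \<in> {pull_back x1 h (ref_deriv 0 0 c) | c. \<forall>i. i \<notin> T \<longrightarrow> c i = 0}"
      then obtain c where "f = pull_back x1 h (ref_deriv 0 0 c)" "\<forall>i. i \<notin> T \<longrightarrow> c i = 0"
        by blast
      moreover from this(2) have "c = (\<lambda>i. if i \<in> T then c i else 0)"
        by auto
      ultimately have "f = (\<Sum>m\<in>T. (\<lambda>z. c m * ?N m z))"
        using eq[of c] by metis
      then show "f \<in> range (\<lambda>k. \<Sum>m\<in>T. (\<lambda>z. k m * ?N m z))"
        by (rule range_eqI[where x = c])
    next
      fix f
      assume "f \<in> range (\<lambda>k. \<Sum>m\<in>T. (\<lambda>z. k m * ?N m z))"
      then obtain k where "f = pull_back x1 h (ref_deriv 0 0 (\<lambda>i. if i \<in> T then k i else 0))"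
        unfolding eq by blast
      then show "f \<in> {pull_back x1 h (ref_deriv 0 0 c) | c. \<forall>i. i \<notin> T \<longrightarrow> c i = 0}"
        by (intro CollectI exI[where x = "\<lambda>i. if i \<in> T then k i else 0"]) simp
    qed
  qed
  finally show ?thesis .
qed

abbreviation triangular_grid :: "(nat \<times> nat) set" where "triangular_grid \<equiv> {(i, j). i + j \<le> 5}"

lemma P_space_5_eq:
  assumes "h \<noteq> 0"
  shows "P_space 5 = {pull_back x1 h (ref_deriv 0 0 c) | c. \<forall>i. i \<notin> triangular_grid \<longrightarrow> c i = 0}"
proof -
  have "P_space 5 = fun_space.span ((\<lambda>(i, j). mono_xy i j) ` triangular_grid)"
    unfolding P_space_def by (rule arg_cong[where f = fun_space.span]) auto
  also have "\<dots> = {pull_back x1 h (ref_deriv 0 0 c) | c. \<forall>i. i \<notin> triangular_grid \<longrightarrow> c i = 0}"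
    using assms by (rule span_mono_xy) auto
  finally show ?thesis .
qed

lemma Q_space_5_eq:
  assumes "h \<noteq> 0"
  shows "Q_space 5 = {pull_back x1 h (ref_deriv 0 0 c) | c. \<forall>i. i \<notin> grid \<longrightarrow> c i = 0}"
proof -
  have "Q_space 5 = fun_space.span ((\<lambda>(i, j). mono_xy i j) ` grid)"
    unfolding Q_space_def by (rule arg_cong[where f = fun_space.span]) auto
  also have "\<dots> = {pull_back x1 h (ref_deriv 0 0 c) | c. \<forall>i. i \<notin> grid \<longrightarrow> c i = 0}"
    using assms by (rule span_mono_xy) auto
  finally show ?thesis .
qed

section \<open>The Bell element\<close>

text \<open>
  The coefficients of \<open>t\<^sup>5\<close> of the \<open>s\<close>-derivative on both vertical edges and of \<open>s\<^sup>5\<close> of the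
  \<open>t\<close>-derivative on both horizontal edges vanish: the Bell condition on the reference square.
\<close>
definition bell_constraint :: "(nat \<times> nat \<Rightarrow> real) \<Rightarrow> bool" where
  "bell_constraint c \<longleftrightarrow> (\<forall>m\<le>1. (\<Sum>p\<le>5. c (p, 5) * monom_deriv 1 p (real m)) = 0) \<and>
     (\<forall>m\<le>1. (\<Sum>q\<le>5. c (5, q) * monom_deriv 1 q (real m)) = 0)"

lemma pull_back_in_W5_iff:
  assumes "h \<noteq> 0" and c: "\<And>i. i \<notin> grid \<Longrightarrow> c i = 0"
  shows "pull_back x1 h (ref_deriv 0 0 c) \<in> W5 x1 h \<longleftrightarrow> bell_constraint c"
proof -
  let ?v = "pull_back x1 h (ref_deriv 0 0 c)"
  have vert: "dir_deriv (u, 0) ?v \<in> edge_Q 4 (x1 + h *\<^sub>R (s, 0)) (x1 + h *\<^sub>R (s, 1)) \<longleftrightarrow>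
      (\<Sum>p\<le>5. c (p, 5) * monom_deriv 1 p s) = 0" if "u \<noteq> 0" for u s
  proof -
    define R where "R q = (\<Sum>p\<le>5. c (p, q) * monom_deriv 1 p s)" for q
    have "dir_deriv (u, 0) ?v (x1 + h *\<^sub>R (s, 0) + t *\<^sub>R (x1 + h *\<^sub>R (s, 1) - (x1 + h *\<^sub>R (s, 0))))
        = (\<Sum>q\<le>5. (u / h * R q) * t ^ q)" for t
    proof -
      have "x1 + h *\<^sub>R (s, 0) + t *\<^sub>R (x1 + h *\<^sub>R (s, 1) - (x1 + h *\<^sub>R (s, 0))) = x1 + h *\<^sub>R (s, t)"
        by (cases x1) simp
      moreover have "ref_deriv 1 0 c s t = (\<Sum>q\<le>5. R q * t ^ q)"
        by (simp add: ref_deriv_rows monom_deriv_0 R_def)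
      ultimately show ?thesis
        by (simp only: dir_deriv_pull_back[OF \<open>h \<noteq> 0\<close>] pull_back_at[OF \<open>h \<noteq> 0\<close>])
          (simp add: sum_distrib_left sum_divide_distrib mult.assoc)
    qed
    then have "dir_deriv (u, 0) ?v \<in> edge_Q 4 (x1 + h *\<^sub>R (s, 0)) (x1 + h *\<^sub>R (s, 1)) \<longleftrightarrow>
      u / h * R 5 = 0"
      unfolding edge_Q_def mem_Collect_eq by (simp only: quintic_degree_le_4_iff)
    with that \<open>h \<noteq> 0\<close> show ?thesis by (simp add: R_def)
  qed
  have horiz: "dir_deriv (0, u) ?v \<in> edge_Q 4 (x1 + h *\<^sub>R (0, t)) (x1 + h *\<^sub>R (1, t)) \<longleftrightarrow>
      (\<Sum>q\<le>5. c (5, q) * monom_deriv 1 q t) = 0" if "u \<noteq> 0" for u t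
  proof -
    define R where "R p = (\<Sum>q\<le>5. c (p, q) * monom_deriv 1 q t)" for p
    have "dir_deriv (0, u) ?v (x1 + h *\<^sub>R (0, t) + s *\<^sub>R (x1 + h *\<^sub>R (1, t) - (x1 + h *\<^sub>R (0, t))))
        = (\<Sum>p\<le>5. (u / h * R p) * s ^ p)" for s
    proof -
      have "x1 + h *\<^sub>R (0, t) + s *\<^sub>R (x1 + h *\<^sub>R (1, t) - (x1 + h *\<^sub>R (0, t))) = x1 + h *\<^sub>R (s, t)"
        by (cases x1) simp
      moreover have "ref_deriv 0 1 c s t = (\<Sum>p\<le>5. R p * s ^ p)"
        by (simp add: ref_deriv_columns monom_deriv_0 R_def)
      ultimately show ?thesis
        by (simp only: dir_deriv_pull_back[OF \<open>h \<noteq> 0\<close>] pull_back_at[OF \<open>h \<noteq> 0\<close>])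
          (simp add: sum_distrib_left sum_divide_distrib mult.assoc)
    qed
    then have "dir_deriv (0, u) ?v \<in> edge_Q 4 (x1 + h *\<^sub>R (0, t)) (x1 + h *\<^sub>R (1, t)) \<longleftrightarrow>
      u / h * R 5 = 0"
      unfolding edge_Q_def mem_Collect_eq by (simp only: quintic_degree_le_4_iff)
    with that \<open>h \<noteq> 0\<close> show ?thesis by (simp add: R_def)
  qed
  have "?v \<in> Q_space 5"
    unfolding Q_space_5_eq[OF \<open>h \<noteq> 0\<close>, of x1] using c by blast
  then have "?v \<in> W5 x1 h \<longleftrightarrow>
      dir_deriv (0, -1) ?v \<in> edge_Q 4 (x1 + h *\<^sub>R (0, 0)) (x1 + h *\<^sub>R (1, 0)) \<and>
      dir_deriv (1, 0) ?v \<in> edge_Q 4 (x1 + h *\<^sub>R (1, 0)) (x1 + h *\<^sub>R (1, 1)) \<and>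
      dir_deriv (0, 1) ?v \<in> edge_Q 4 (x1 + h *\<^sub>R (0, 1)) (x1 + h *\<^sub>R (1, 1)) \<and>
      dir_deriv (-1, 0) ?v \<in> edge_Q 4 (x1 + h *\<^sub>R (0, 0)) (x1 + h *\<^sub>R (0, 1))"
    by (simp add: W5_def square_edges_def zero_prod_def[symmetric])
  also have "\<dots> \<longleftrightarrow> bell_constraint c"
  proof -
    have all_le_1: "(\<forall>m\<le>1. P (real m)) \<longleftrightarrow> P 0 \<and> P 1" for P
      by (auto simp: le_Suc_eq)
    have nonzero: "(1::real) \<noteq> 0" "(-1::real) \<noteq> 0"
      by simp_all
    show ?thesis
      unfolding bell_constraint_def
        vert[OF nonzero(1)] vert[OF nonzero(2)] horiz[OF nonzero(1)] horiz[OF nonzero(2)]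
        all_le_1[of "\<lambda>m. (\<Sum>p\<le>5. c (p, 5) * monom_deriv 1 p m) = 0"]
        all_le_1[of "\<lambda>m. (\<Sum>q\<le>5. c (5, q) * monom_deriv 1 q m) = 0"]
      by blast
  qed
  finally show ?thesis .
qed

text \<open>
  The normal derivatives on the edges come first, because they supply the tangential end
  conditions for the lines \<open>s = 1/3\<close> and \<open>s = 2/3\<close>, whose endpoints carry no first-order functional.
\<close>
lemma bell_coefficients_eq_0:
  assumes z: "\<And>d. d \<in> bell_index \<Longrightarrow> ref_dof d (\<lambda>k l. ref_deriv k l c) = 0"
    and "bell_constraint c" and "(p, q) \<in> grid"
  shows "c (p, q) = 0"
proof -
  have val: "ref_deriv 0 0 c (real m / 3) (real n / 3) = 0" if "m \<le> 3" "n \<le> 3" for m n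
    using z[of "(1, m, n)"] that by (simp add: bell_index_def ref_dof_def)
  have dx: "ref_deriv 1 0 c (real m) (real n / 2) = 0" if "m \<le> 1" "n \<le> 2" for m n
    using z[of "(2, m, n)"] that by (simp add: bell_index_def ref_dof_def)
  have dy: "ref_deriv 0 1 c (real m / 2) (real n) = 0" if "m \<le> 2" "n \<le> 1" for m n
    using z[of "(3, m, n)"] that by (simp add: bell_index_def ref_dof_def)
  have dxy: "ref_deriv 1 1 c (real m) (real n) = 0" if "m \<le> 1" "n \<le> 1" for m n
    using z[of "(4, m, n)"] that by (simp add: bell_index_def ref_dof_def)
  have normal_x: "(\<Sum>p\<le>5. c (p, q) * monom_deriv 1 p (real m)) = 0" if "m \<le> 1" "q \<le> 5" for m q
  proof (rule quartic_eq_0[where a = "\<lambda>q. \<Sum>p\<le>5. c (p, q) * monom_deriv 1 p (real m)"])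
    show "(\<Sum>q\<le>5. (\<Sum>p\<le>5. c (p, q) * monom_deriv 1 p (real m)) * monom_deriv 0 q (real n / 2)) = 0"
      if "n \<le> 2" for n
      using dx[OF \<open>m \<le> 1\<close> that] unfolding ref_deriv_rows .
    show "(\<Sum>q\<le>5. (\<Sum>p\<le>5. c (p, q) * monom_deriv 1 p (real m)) * monom_deriv 1 q (real n)) = 0"
      if "n \<le> 1" for n
      using dxy[OF \<open>m \<le> 1\<close> that] unfolding ref_deriv_rows .
    show "(\<Sum>p\<le>5. c (p, 5) * monom_deriv 1 p (real m)) = 0"
      using \<open>bell_constraint c\<close> \<open>m \<le> 1\<close> unfolding bell_constraint_def by blast
  qed (rule \<open>q \<le> 5\<close>)
  have normal_y: "(\<Sum>q\<le>5. c (p, q) * monom_deriv 1 q (real n)) = 0" if "n \<le> 1" "p \<le> 5" for n p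
  proof (rule quartic_eq_0[where a = "\<lambda>p. \<Sum>q\<le>5. c (p, q) * monom_deriv 1 q (real n)"])
    show "(\<Sum>p\<le>5. (\<Sum>q\<le>5. c (p, q) * monom_deriv 1 q (real n)) * monom_deriv 0 p (real m / 2)) = 0"
      if "m \<le> 2" for m
      using dy[OF that \<open>n \<le> 1\<close>] unfolding ref_deriv_columns .
    show "(\<Sum>p\<le>5. (\<Sum>q\<le>5. c (p, q) * monom_deriv 1 q (real n)) * monom_deriv 1 p (real m)) = 0"
      if "m \<le> 1" for m
      using dxy[OF that \<open>n \<le> 1\<close>] unfolding ref_deriv_columns .
    show "(\<Sum>q\<le>5. c (5, q) * monom_deriv 1 q (real n)) = 0"
      using \<open>bell_constraint c\<close> \<open>n \<le> 1\<close> unfolding bell_constraint_def by blast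
  qed (rule \<open>p \<le> 5\<close>)
  have line: "(\<Sum>p\<le>5. c (p, q) * monom_deriv 0 p (real m / 3)) = 0" if "m \<le> 3" "q \<le> 5" for m q
  proof (rule quintic_eq_0[where a = "\<lambda>q. \<Sum>p\<le>5. c (p, q) * monom_deriv 0 p (real m / 3)"])
    show "(\<Sum>q\<le>5. (\<Sum>p\<le>5. c (p, q) * monom_deriv 0 p (real m / 3)) * monom_deriv 0 q (real n / 3)) = 0"
      if "n \<le> 3" for n
      using val[OF \<open>m \<le> 3\<close> that] unfolding ref_deriv_rows .
    show "(\<Sum>q\<le>5. (\<Sum>p\<le>5. c (p, q) * monom_deriv 0 p (real m / 3)) * monom_deriv 1 q (real n)) = 0"
      if "n \<le> 1" for n
      unfolding ref_deriv_rows[symmetric] ref_deriv_columns using normal_y[OF that] by simp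
  qed (rule \<open>q \<le> 5\<close>)
  show ?thesis
  proof (rule quintic_eq_0[where a = "\<lambda>p. c (p, q)"])
    show "(\<Sum>p\<le>5. c (p, q) * monom_deriv 0 p (real m / 3)) = 0" if "m \<le> 3" for m
      using line[OF that] \<open>(p, q) \<in> grid\<close> by blast
    show "(\<Sum>p\<le>5. c (p, q) * monom_deriv 1 p (real m)) = 0" if "m \<le> 1" for m
      using normal_x[OF that] \<open>(p, q) \<in> grid\<close> by blast
  qed (use \<open>(p, q) \<in> grid\<close> in blast)
qed

text \<open>
  The matrix of the 36 by 36 system. The left summand indexes the degrees of freedom; on the right,
  \<open>(0, m)\<close> is the constraint on the vertical edge \<open>s = m\<close>, and \<open>(e, m)\<close> with \<open>e \<noteq> 0\<close> the one on
  the horizontal edge \<open>t = m\<close>.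
\<close>
definition bell_matrix :: "nat \<times> nat \<Rightarrow> (nat \<times> nat \<times> nat) + (nat \<times> nat) \<Rightarrow> real" where
  "bell_matrix i = case_sum (\<lambda>d. ref_dof d (\<lambda>k l s t. monom_deriv k (fst i) s * monom_deriv l (snd i) t))
     (\<lambda>(e, m). if e = 0 then (if snd i = 5 then monom_deriv 1 (fst i) (real m) else 0)
       else (if fst i = 5 then monom_deriv 1 (snd i) (real m) else 0))"

lemma sum_bell_matrix:
  "(\<Sum>i\<in>grid. c i * bell_matrix i (Inl d)) = ref_dof d (\<lambda>k l. ref_deriv k l c)"
  "(\<Sum>i\<in>grid. c i * bell_matrix i (Inr (0, m))) = (\<Sum>p\<le>5. c (p, 5) * monom_deriv 1 p (real m))"
  "(\<Sum>i\<in>grid. c i * bell_matrix i (Inr (Suc 0, m))) = (\<Sum>q\<le>5. c (5, q) * monom_deriv 1 q (real m))"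
proof -
  show "(\<Sum>i\<in>grid. c i * bell_matrix i (Inl d)) = ref_dof d (\<lambda>k l. ref_deriv k l c)"
    by (simp add: ref_dof_eq_sum bell_matrix_def)
  have "(\<Sum>i\<in>grid. c i * bell_matrix i (Inr (0, m))) =
      (\<Sum>p\<le>5. \<Sum>q\<le>5. if q = 5 then c (p, q) * monom_deriv 1 p (real m) else 0)"
    unfolding sum.cartesian_product
    by (intro sum.cong refl) (auto simp: bell_matrix_def)
  then show "(\<Sum>i\<in>grid. c i * bell_matrix i (Inr (0, m))) = (\<Sum>p\<le>5. c (p, 5) * monom_deriv 1 p (real m))"
    by simp
  have "(\<Sum>i\<in>grid. c i * bell_matrix i (Inr (Suc 0, m))) =
      (\<Sum>p\<le>5. if p = 5 then \<Sum>q\<le>5. c (p, q) * monom_deriv 1 q (real m) else 0)"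
  proof -
    have "(\<Sum>i\<in>grid. c i * bell_matrix i (Inr (Suc 0, m))) =
        (\<Sum>p\<le>5. \<Sum>q\<le>5. c (p, q) * bell_matrix (p, q) (Inr (Suc 0, m)))"
      by (simp add: sum.cartesian_product)
    also have "\<dots> = (\<Sum>p\<le>5. if p = 5 then \<Sum>q\<le>5. c (p, q) * monom_deriv 1 q (real m) else 0)"
      by (intro sum.cong refl) (auto simp: bell_matrix_def)
    finally show ?thesis .
  qed
  then show "(\<Sum>i\<in>grid. c i * bell_matrix i (Inr (Suc 0, m))) = (\<Sum>q\<le>5. c (5, q) * monom_deriv 1 q (real m))"
    by simp
qed

lemma finite_bell_index: "finite bell_index"
  by (simp add: bell_index_def)

lemma card_bell_index: "card bell_index = 32"
  by code_simp

lemma ref_deriv_restrict: "ref_deriv k l (\<lambda>i. if i \<in> grid then c i else 0) = ref_deriv k l c"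
  by (auto simp: fun_eq_iff ref_deriv_def intro!: sum.cong)

lemma bell_constraint_restrict:
  "bell_constraint (\<lambda>i. if i \<in> grid then c i else 0) \<longleftrightarrow> bell_constraint c"
proof -
  have "(\<Sum>p\<le>5. (if (p, 5) \<in> grid then c (p, 5) else 0) * monom_deriv 1 p s) =
      (\<Sum>p\<le>5. c (p, 5) * monom_deriv 1 p s)" for s
    by (intro sum.cong) auto
  moreover have "(\<Sum>q\<le>5. (if (5, q) \<in> grid then c (5, q) else 0) * monom_deriv 1 q t) =
      (\<Sum>q\<le>5. c (5, q) * monom_deriv 1 q t)" for t
    by (intro sum.cong) auto
  ultimately show ?thesis
    unfolding bell_constraint_def by presburger
qed

text \<open>
  The system that \<open>bell_coefficients_eq_0\<close> shows to be injective is square, as 36 = 32 + 4. The prescribed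
  values are multiplied by powers of \<open>h\<close> to pass to the reference square.
\<close>
lemma bell_unisolvent:
  assumes "h \<noteq> 0"
  shows "\<exists>!b. b \<in> W5 x1 h \<and> (\<forall>d\<in>bell_index. bell_dof x1 h d b = y d)"
proof -
  let ?J = "bell_index <+> ({0..1::nat} \<times> {0..1::nat})"
  have "\<exists>c. \<forall>j\<in>?J. (\<Sum>i\<in>grid. c i * bell_matrix i j) =
      case_sum (\<lambda>d. y d * h ^ dof_order d) (\<lambda>_. 0) j"
  proof (rule square_system_solvable[of grid ?J bell_matrix])
    show "card grid = card ?J"
      by (simp add: card_Plus finite_bell_index card_bell_index)
    fix c i
    assume *: "\<And>j. j \<in> ?J \<Longrightarrow> (\<Sum>i\<in>grid. c i * bell_matrix i j) = 0" and "i \<in> grid"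
    have "ref_dof d (\<lambda>k l. ref_deriv k l c) = 0" if "d \<in> bell_index" for d
      using *[of "Inl d"] that by (simp only: sum_bell_matrix InlI)
    moreover have "bell_constraint c"
      using *[of "Inr (0, m)" for m] *[of "Inr (Suc 0, m)" for m]
      by (simp add: bell_constraint_def sum_bell_matrix InrI)
    ultimately show "c i = 0"
      using \<open>i \<in> grid\<close> bell_coefficients_eq_0[of c "fst i" "snd i"] by simp
  qed (auto simp: finite_bell_index)
  then obtain c where c: "\<And>j. j \<in> ?J \<Longrightarrow> (\<Sum>i\<in>grid. c i * bell_matrix i j) =
      case_sum (\<lambda>d. y d * h ^ dof_order d) (\<lambda>_. 0) j"
    by blast
  define b where "b = pull_back x1 h (ref_deriv 0 0 (\<lambda>i. if i \<in> grid then c i else 0))"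
  have "bell_constraint c"
    using c[of "Inr (0, m)" for m] c[of "Inr (Suc 0, m)" for m]
    by (simp add: bell_constraint_def sum_bell_matrix InrI)
  then have "bell_constraint (\<lambda>i. if i \<in> grid then c i else 0)"
    unfolding bell_constraint_restrict .
  then have "b \<in> W5 x1 h"
    unfolding b_def by (subst pull_back_in_W5_iff) (use assms in auto)
  moreover have "bell_dof x1 h d b = y d" if "d \<in> bell_index" for d
    using c[of "Inl d"] that assms unfolding b_def bell_dof_pull_back[OF assms] ref_deriv_restrict
    by (simp add: sum_bell_matrix InlI)
  moreover have "v = w" if v: "v \<in> W5 x1 h" "\<forall>d\<in>bell_index. bell_dof x1 h d v = y d"
    and w: "w \<in> W5 x1 h" "\<forall>d\<in>bell_index. bell_dof x1 h d w = y d" for v w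
  proof -
    have "v \<in> Q_space 5" "w \<in> Q_space 5"
      using v w by (auto simp: W5_def)
    then obtain f g where
        f: "v = pull_back x1 h (ref_deriv 0 0 f)" "\<And>i. i \<notin> grid \<Longrightarrow> f i = 0" and
        g: "w = pull_back x1 h (ref_deriv 0 0 g)" "\<And>i. i \<notin> grid \<Longrightarrow> g i = 0"
      unfolding Q_space_5_eq[OF assms, of x1] by blast
    have "bell_constraint f" "bell_constraint g"
      using pull_back_in_W5_iff[OF assms f(2)] pull_back_in_W5_iff[OF assms g(2)] v w f g by auto
    then have "bell_constraint (\<lambda>i. f i - g i)"
      by (simp add: bell_constraint_def left_diff_distrib sum_subtractf)
    moreover have "ref_dof d (\<lambda>k l. ref_deriv k l (\<lambda>i. f i - g i)) = 0" if "d \<in> bell_index" for d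
    proof -
      have "bell_dof x1 h d v = bell_dof x1 h d w"
        using v(2) w(2) that by simp
      then show ?thesis
        using assms by (simp add: f(1) g(1) bell_dof_pull_back ref_dof_diff)
    qed
    ultimately have eq: "f (p, q) - g (p, q) = 0" if "(p, q) \<in> grid" for p q
      using that by (intro bell_coefficients_eq_0[of "\<lambda>i. f i - g i"])
    have "f = g"
    proof
      fix i
      show "f i = g i"
        using eq[of "fst i" "snd i"] f(2)[of i] g(2)[of i] by (cases "i \<in> grid") simp_all
    qed
    then show ?thesis
      using f g by simp
  qed
  ultimately show ?thesis
    by blast
qed

lemma bell_basis:
  assumes "h \<noteq> 0"
  shows "bell_basis x1 h l i j \<in> W5 x1 h"
    and "d \<in> bell_index \<Longrightarrow> bell_dof x1 h d (bell_basis x1 h l i j) = (if d = (l, i, j) then 1 else 0)"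
proof -
  let ?P = "\<lambda>b. b \<in> W5 x1 h \<and>
    (\<forall>d\<in>bell_index. bell_dof x1 h d b = (if d = (l, i, j) then 1 else 0))"
  have "?P (bell_basis x1 h l i j)"
    unfolding bell_basis_def
    by (rule theI'[OF bell_unisolvent[OF assms, of x1 "\<lambda>d. if d = (l, i, j) then 1 else 0"]])
  then show "bell_basis x1 h l i j \<in> W5 x1 h"
    and "d \<in> bell_index \<Longrightarrow> bell_dof x1 h d (bell_basis x1 h l i j) = (if d = (l, i, j) then 1 else 0)"
    by blast+
qed

lemma Q_space_5_E:
  assumes "h \<noteq> 0" "f \<in> Q_space 5"
  obtains c where "f = pull_back x1 h (ref_deriv 0 0 c)"
  using assms(2) that unfolding Q_space_5_eq[OF assms(1), of x1] by blast

text \<open>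
  The degrees of freedom are built from Frechet derivatives, which are additive only on
  differentiable functions; hence linearity is stated on \<open>Q\<^sub>5\<close>.
\<close>
lemma bell_dof_add:
  assumes "h \<noteq> 0" "f \<in> Q_space 5" "g \<in> Q_space 5"
  shows "bell_dof x1 h d (f + g) = bell_dof x1 h d f + bell_dof x1 h d g"
proof -
  obtain a where f: "f = pull_back x1 h (ref_deriv 0 0 a)"
    by (rule Q_space_5_E[OF assms(1,2)])
  obtain b where g: "g = pull_back x1 h (ref_deriv 0 0 b)"
    by (rule Q_space_5_E[OF assms(1,3)])
  have "f + g = pull_back x1 h (ref_deriv 0 0 (\<lambda>i. a i + b i))"
    by (simp add: f g fun_eq_iff pull_back_def ref_deriv_add)
  then show ?thesis
    using assms(1)
    by (simp add: f g bell_dof_pull_back ref_dof_eq_sum distrib_right sum.distrib add_divide_distrib)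
qed

lemma bell_dof_scale:
  assumes "h \<noteq> 0" "f \<in> Q_space 5"
  shows "bell_dof x1 h d (\<lambda>z. r * f z) = r * bell_dof x1 h d f"
proof -
  obtain a where f: "f = pull_back x1 h (ref_deriv 0 0 a)"
    by (rule Q_space_5_E[OF assms])
  have "(\<lambda>z. r * f z) = pull_back x1 h (ref_deriv 0 0 (\<lambda>i. r * a i))"
    by (simp add: f fun_eq_iff pull_back_def ref_deriv_scale)
  then show ?thesis
    using assms(1)
    by (simp add: f bell_dof_pull_back ref_dof_eq_sum sum_distrib_left mult.assoc)
qed

lemma zero_in_Q_space: "0 \<in> Q_space n"
  unfolding Q_space_def by (rule fun_space.span_zero)

lemma bell_dof_sum:
  assumes "h \<noteq> 0" "\<And>m. m \<in> M \<Longrightarrow> f m \<in> Q_space 5"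
  shows "bell_dof x1 h d (\<Sum>m\<in>M. f m) = (\<Sum>m\<in>M. bell_dof x1 h d (f m))"
proof -
  have "bell_dof x1 h d 0 = 0"
    using bell_dof_scale[OF assms(1) zero_in_Q_space, of x1 d 0] by (simp add: zero_fun_def)
  moreover have "(\<Sum>m\<in>N. f m) \<in> Q_space 5" if "N \<subseteq> M" for N
    using assms(2) that unfolding Q_space_def by (intro fun_space.span_sum) auto
  ultimately show ?thesis
    using assms
  proof (induction M rule: infinite_finite_induct)
    case (insert m M)
    then have "bell_dof x1 h d (sum f (insert m M)) = bell_dof x1 h d (f m) + bell_dof x1 h d (sum f M)"
      unfolding sum.insert[OF insert.hyps] by (intro bell_dof_add) auto
    also have "bell_dof x1 h d (sum f M) = (\<Sum>m\<in>M. bell_dof x1 h d (f m))"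
      by (rule insert.IH) (use insert.prems in auto)
    finally show ?case
      unfolding sum.insert[OF insert.hyps] .
  qed auto
qed

section \<open>The reduced space\<close>

definition interior_index :: "(nat \<times> nat \<times> nat) set" where
  "interior_index = {1} \<times> {1..2} \<times> {1..2}"

text \<open>The indices of the seven Bell functions that are added to \<open>P\<^sub>5\<close>.\<close>
definition added_index :: "(nat \<times> nat \<times> nat) set" where
  "added_index = {(1, 1, 0), (1, 2, 0), (1, 3, 0), (3, 1, 0), (2, 1, 0), (3, 2, 0), (4, 1, 0)}"

text \<open>
  \<open>added_index\<close> consists of the functionals at the lower right vertex and those interior to the bottom
  edge, so that the left and the top edge keep all of theirs. A polynomial that vanishes there together
  with its normal derivative is \<open>s\<^sup>2 (1 - t)\<^sup>2\<close> times a linear factor, and the three functionals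
  interior to the right edge force that factor to be zero.
\<close>
lemma P5_coefficients_eq_0:
  assumes z: "\<And>d. d \<in> bell_index - interior_index - added_index \<Longrightarrow> ref_dof d (\<lambda>k l. ref_deriv k l c) = 0"
    and c: "\<And>i. i \<notin> triangular_grid \<Longrightarrow> c i = 0"
  shows "c (p, q) = 0"
proof -
  note index_defs = bell_index_def interior_index_def added_index_def
  have left_value: "(\<Sum>p\<le>5. c (p, q) * monom_deriv 0 p 0) = 0" if "q \<le> 5" for q
  proof (rule quintic_eq_0[where a = "\<lambda>q. \<Sum>p\<le>5. c (p, q) * monom_deriv 0 p 0"])
    show "(\<Sum>q\<le>5. (\<Sum>p\<le>5. c (p, q) * monom_deriv 0 p 0) * monom_deriv 0 q (real n / 3)) = 0" if "n \<le> 3" for n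
      using z[of "(1, 0, n)"] that unfolding ref_deriv_rows[symmetric] by (simp add: index_defs ref_dof_def)
    show "(\<Sum>q\<le>5. (\<Sum>p\<le>5. c (p, q) * monom_deriv 0 p 0) * monom_deriv 1 q (real n)) = 0" if "n \<le> 1" for n
      using z[of "(3, 0, n)"] that unfolding ref_deriv_rows[symmetric] by (simp add: index_defs ref_dof_def)
  qed (rule that)
  have left_normal: "(\<Sum>p\<le>5. c (p, q) * monom_deriv 1 p 0) = 0" if "q \<le> 5" for q
  proof (rule quartic_eq_0[where a = "\<lambda>q. \<Sum>p\<le>5. c (p, q) * monom_deriv 1 p 0"])
    show "(\<Sum>q\<le>5. (\<Sum>p\<le>5. c (p, q) * monom_deriv 1 p 0) * monom_deriv 0 q (real n / 2)) = 0" if "n \<le> 2" for n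
      using z[of "(2, 0, n)"] that unfolding ref_deriv_rows[symmetric] by (simp add: index_defs ref_dof_def)
    show "(\<Sum>q\<le>5. (\<Sum>p\<le>5. c (p, q) * monom_deriv 1 p 0) * monom_deriv 1 q (real n)) = 0" if "n \<le> 1" for n
      using z[of "(4, 0, n)"] that unfolding ref_deriv_rows[symmetric] by (simp add: index_defs ref_dof_def)
    \<comment> \<open>Here total degree 5 plays the part of the Bell condition: \<open>s t\<^sup>5\<close> does not occur.\<close>
    show "(\<Sum>p\<le>5. c (p, 5) * monom_deriv 1 p 0) = 0"
      using c[of "(Suc p, 5)" for p] by (simp add: sum_atMost_5 monom_deriv_1)
  qed (rule that)
  have top_value: "(\<Sum>q\<le>5. c (p, q) * monom_deriv 0 q 1) = 0" if "p \<le> 5" for p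
  proof (rule quintic_eq_0[where a = "\<lambda>p. \<Sum>q\<le>5. c (p, q) * monom_deriv 0 q 1"])
    show "(\<Sum>p\<le>5. (\<Sum>q\<le>5. c (p, q) * monom_deriv 0 q 1) * monom_deriv 0 p (real m / 3)) = 0" if "m \<le> 3" for m
      using z[of "(1, m, 3)"] that unfolding ref_deriv_columns[symmetric] by (simp add: index_defs ref_dof_def)
    show "(\<Sum>p\<le>5. (\<Sum>q\<le>5. c (p, q) * monom_deriv 0 q 1) * monom_deriv 1 p (real m)) = 0" if "m \<le> 1" for m
      using z[of "(2, m, 2)"] that unfolding ref_deriv_columns[symmetric] by (simp add: index_defs ref_dof_def)
  qed (rule that)
  have top_normal: "(\<Sum>q\<le>5. c (p, q) * monom_deriv 1 q 1) = 0" if "p \<le> 5" for p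
  proof (rule quartic_eq_0[where a = "\<lambda>p. \<Sum>q\<le>5. c (p, q) * monom_deriv 1 q 1"])
    show "(\<Sum>p\<le>5. (\<Sum>q\<le>5. c (p, q) * monom_deriv 1 q 1) * monom_deriv 0 p (real m / 2)) = 0" if "m \<le> 2" for m
      using z[of "(3, m, 1)"] that unfolding ref_deriv_columns[symmetric] by (simp add: index_defs ref_dof_def)
    show "(\<Sum>p\<le>5. (\<Sum>q\<le>5. c (p, q) * monom_deriv 1 q 1) * monom_deriv 1 p (real m)) = 0" if "m \<le> 1" for m
      using z[of "(4, m, 1)"] that unfolding ref_deriv_columns[symmetric] by (simp add: index_defs ref_dof_def)
    show "(\<Sum>q\<le>5. c (5, q) * monom_deriv 1 q 1) = 0"
      using c[of "(5, 1)"] c[of "(5, 2)"] c[of "(5, 3)"] c[of "(5, 4)"] c[of "(5, 5)"]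
      by (simp add: sum_atMost_5 monom_deriv_1)
  qed (rule that)
  have right_value: "ref_deriv 0 0 c 1 (1 / 3) = 0" "ref_deriv 0 0 c 1 (2 / 3) = 0"
    using z[of "(1, 3, 1)"] z[of "(1, 3, 2)"] by (simp_all add: index_defs ref_dof_def)
  have right_normal: "ref_deriv 1 0 c 1 (1 / 2) = 0"
    using z[of "(2, 1, 1)"] by (simp add: index_defs ref_dof_def)
  have high: "c (p, q) = 0" if "p + q > 5" for p q
    using c[of "(p, q)"] that by simp
  have first_columns: "c (0, q) = 0" "c (1, q) = 0" if "q \<le> 5" for q
    using left_value[OF that] left_normal[OF that] by (simp_all add: sum_atMost_5 monom_deriv_0 monom_deriv_1)
  \<comment> \<open>Column \<open>p\<close> collects the coefficients of \<open>s\<^sup>p\<close>; as a polynomial in \<open>t\<close> it has a double zero at 1.\<close>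
  have column_5: "c (5, 0) = 0"
    using top_value[of 5] by (simp add: sum_atMost_5 monom_deriv_0 high)
  have column_4: "c (4, 1) = 0" "c (4, 0) = 0"
    using top_value[of 4] top_normal[of 4] by (simp_all add: sum_atMost_5 monom_deriv_0 monom_deriv_1 high)
  have column_3: "c (3, 1) = -2 * c (3, 2)" "c (3, 0) = c (3, 2)"
    using top_value[of 3] top_normal[of 3] by (simp_all add: sum_atMost_5 monom_deriv_0 monom_deriv_1 high)
  have column_2: "c (2, 1) = -2 * c (2, 2) - 3 * c (2, 3)" "c (2, 0) = c (2, 2) + 2 * c (2, 3)"
    using top_value[of 2] top_normal[of 2] by (simp_all add: sum_atMost_5 monom_deriv_0 monom_deriv_1 high)
  \<comment> \<open>By now the polynomial is \<open>s\<^sup>2 (1 - t)\<^sup>2 (A + B s + C t)\<close> with \<open>A = c (2, 2) + 2 c (2, 3)\<close>,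
    \<open>B = c (3, 2)\<close> and \<open>C = c (2, 3)\<close>. The next equations are \<open>A + B + C t = 0\<close> at \<open>t = 1/3\<close> and
    at \<open>t = 2/3\<close>, and \<open>2 A + 3 B + 2 C t = 0\<close>, from the \<open>s\<close>-derivative, at \<open>t = 1/2\<close>.\<close>
  have right_1: "c (2, 2) + 2 * c (2, 3) + c (3, 2) + c (2, 3) / 3 = 0"
    using right_value(1) first_columns column_5 column_4 column_3 column_2
    by (simp add: ref_deriv_columns sum_atMost_5 monom_deriv_0 high power_divide field_simps)
  have right_2: "c (2, 2) + 2 * c (2, 3) + c (3, 2) + 2 * c (2, 3) / 3 = 0"
    using right_value(2) first_columns column_5 column_4 column_3 column_2
    by (simp add: ref_deriv_columns sum_atMost_5 monom_deriv_0 high power_divide field_simps)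
  have right_3: "2 * (c (2, 2) + 2 * c (2, 3)) + 3 * c (3, 2) + c (2, 3) = 0"
    using right_normal first_columns column_5 column_4 column_3 column_2
    by (simp add: ref_deriv_columns sum_atMost_5 monom_deriv_0 monom_deriv_1 high power_divide)
  have "c (2, 3) = 0"
    using right_1 right_2 by simp
  moreover from this have "c (3, 2) = 0"
    using right_2 right_3 by simp
  ultimately have rest: "c i = 0" if
    "i \<in> {(5, 0), (4, 0), (4, 1), (3, 0), (3, 1), (3, 2), (2, 0), (2, 1), (2, 2), (2, 3)}" for i
    using that right_1 column_5 column_4 column_3 column_2 by auto
  have "p + q > 5 \<or> p = 0 \<and> q \<le> 5 \<or> p = 1 \<and> q \<le> 5 \<or>
    (p, q) \<in> {(5, 0), (4, 0), (4, 1), (3, 0), (3, 1), (3, 2), (2, 0), (2, 1), (2, 2), (2, 3)}"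
    by (simp; presburger)
  then show ?thesis
    using high[of p q] first_columns[of q] rest[of "(p, q)"] by (elim disjE conjE) (simp_all only:)
qed

lemma card_triangular_grid: "finite triangular_grid" "card triangular_grid = 21"
proof -
  have eq: "triangular_grid = (SIGMA p:{..5}. {..5 - p})"
    by auto
  show "finite triangular_grid" "card triangular_grid = 21"
    unfolding eq by (simp_all add: sum_atMost_5)
qed

lemma interior_added_index:
  "interior_index \<subseteq> bell_index" "added_index \<subseteq> bell_index - interior_index"
  "finite added_index" "card (bell_index - interior_index - added_index) = 21"
proof -
  show 1: "interior_index \<subseteq> bell_index" "added_index \<subseteq> bell_index - interior_index"
    "finite added_index"
    by (auto simp: interior_index_def added_index_def bell_index_def)
  have "card (bell_index - interior_index) = 28"
    using 1(1) by (subst card_Diff_subset) 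
      (auto simp: card_bell_index interior_index_def card_cartesian_product)
  moreover have "card added_index = 7"
    by (simp add: added_index_def)
  ultimately show "card (bell_index - interior_index - added_index) = 21"
    using 1 by (subst card_Diff_subset) auto
qed

lemma P_space_5_subset_Q_space_5: "P_space 5 \<subseteq> Q_space 5"
  unfolding P_space_def Q_space_def
proof (rule fun_space.span_mono, rule subsetI)
  fix f
  assume "f \<in> {mono_xy i j | i j. i + j \<le> 5}"
  then obtain i j where "f = mono_xy i j" "i + j \<le> 5"
    by blast
  moreover from this(2) have "i \<le> 5" "j \<le> 5"
    by auto
  ultimately show "f \<in> {mono_xy i j | i j. i \<le> 5 \<and> j \<le> 5}"
    by blast
qed

lemma P5_interpolation_unique:
  assumes "h \<noteq> 0" "p \<in> P_space 5"
    and z: "\<And>d. d \<in> bell_index - interior_index - added_index \<Longrightarrow> bell_dof x1 h d p = 0"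
  shows "p = 0"
proof -
  obtain c where p: "p = pull_back x1 h (ref_deriv 0 0 c)" and c: "\<And>i. i \<notin> triangular_grid \<Longrightarrow> c i = 0"
    using assms(2) unfolding P_space_5_eq[OF assms(1), of x1] by blast
  have "c (i, j) = 0" for i j
  proof (rule P5_coefficients_eq_0)
    show "ref_dof d (\<lambda>k l. ref_deriv k l c) = 0" if "d \<in> bell_index - interior_index - added_index" for d
      using z[OF that] assms(1) by (simp add: p bell_dof_pull_back)
  qed (rule c)
  then show ?thesis
    by (simp add: p ref_deriv_def pull_back_def fun_eq_iff case_prod_unfold)
qed

lemma P5_interpolation_exists:
  assumes "h \<noteq> 0"
  shows "\<exists>p\<in>P_space 5. \<forall>d\<in>bell_index - interior_index - added_index. bell_dof x1 h d p = y d"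
proof -
  let ?K = "bell_index - interior_index - added_index"
  let ?A = "\<lambda>i d. ref_dof d (\<lambda>k l s t. monom_deriv k (fst i) s * monom_deriv l (snd i) t)"
  let ?r = "\<lambda>c i. if i \<in> triangular_grid then c i else 0"
  have r: "(\<Sum>i\<in>triangular_grid. c i * ?A i d) = ref_dof d (\<lambda>k l. ref_deriv k l (?r c))" for c d
    unfolding ref_dof_eq_sum by (intro sum.mono_neutral_cong_left) auto
  have "\<exists>c. \<forall>d\<in>?K. (\<Sum>i\<in>triangular_grid. c i * ?A i d) = y d * h ^ dof_order d"
  proof (rule square_system_solvable)
    show "finite ?K"
      using finite_bell_index by blast
    show "card triangular_grid = card ?K"
      using card_triangular_grid interior_added_index by simp
    fix c i
    assume *: "\<And>d. d \<in> ?K \<Longrightarrow> (\<Sum>i\<in>triangular_grid. c i * ?A i d) = 0" and i: "i \<in> triangular_grid"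
    have "?r c (fst i, snd i) = 0"
    proof (rule P5_coefficients_eq_0)
      show "ref_dof d (\<lambda>k l. ref_deriv k l (?r c)) = 0" if "d \<in> ?K" for d
        using *[OF that] unfolding r .
    qed simp
    with i show "c i = 0" by auto
  qed (rule card_triangular_grid)
  then obtain c where c: "\<And>d. d \<in> ?K \<Longrightarrow> ref_dof d (\<lambda>k l. ref_deriv k l (?r c)) = y d * h ^ dof_order d"
    unfolding r by blast
  show ?thesis
  proof (intro bexI ballI)
    show "bell_dof x1 h d (pull_back x1 h (ref_deriv 0 0 (?r c))) = y d" if "d \<in> ?K" for d
      using c[OF that] assms unfolding bell_dof_pull_back[OF assms] by simp
    have "\<forall>i. i \<notin> triangular_grid \<longrightarrow> ?r c i = 0"
      by simp
    then show "pull_back x1 h (ref_deriv 0 0 (?r c)) \<in> P_space 5"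
      unfolding P_space_5_eq[OF assms, of x1] by blast
  qed
qed

definition bell_function ::
    "real \<times> real \<Rightarrow> real \<Rightarrow> nat \<times> nat \<times> nat \<Rightarrow> real \<times> real \<Rightarrow> real" where
  "bell_function x1 h = (\<lambda>(l, i, j). bell_basis x1 h l i j)"

lemma bell_function:
  assumes "h \<noteq> 0"
  shows "bell_function x1 h m \<in> Q_space 5"
    and "d \<in> bell_index \<Longrightarrow> bell_dof x1 h d (bell_function x1 h m) = (if d = m then 1 else 0)"
proof -
  obtain l i j where m: "m = (l, i, j)"
    by (metis prod.exhaust)
  show "bell_function x1 h m \<in> Q_space 5"
    using bell_basis(1)[OF assms] by (simp add: m bell_function_def W5_def)
  show "bell_dof x1 h d (bell_function x1 h m) = (if d = m then 1 else 0)" if "d \<in> bell_index"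
    using bell_basis(2)[OF assms that] by (simp add: m bell_function_def)
qed

lemma V5_eq:
  "V5 x1 h = {p + (\<Sum>m\<in>added_index. (\<lambda>z. k m * bell_function x1 h m z)) | p k. p \<in> P_space 5}"
proof -
  have "V5 x1 h = fun_space.span (P_space 5 \<union> bell_function x1 h ` added_index)"
    unfolding V5_def by (rule arg_cong[where f = fun_space.span])
      (auto simp: added_index_def bell_function_def)
  also have "\<dots> = {p + b | p b. p \<in> fun_space.span (P_space 5) \<and>
      b \<in> fun_space.span (bell_function x1 h ` added_index)}"
    by (rule fun_space.span_Un)
  also have "fun_space.span (P_space 5) = P_space 5"
    unfolding P_space_def by (rule fun_space.span_span)
  also have "fun_space.span (bell_function x1 h ` added_index) =
      range (\<lambda>k. \<Sum>m\<in>added_index. (\<lambda>z. k m * bell_function x1 h m z))"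
    by (rule fun_space.span_image_finite) (rule interior_added_index)
  finally show ?thesis
    by blast
qed

lemma bell_dof_V5:
  assumes "h \<noteq> 0" "p \<in> P_space 5" "d \<in> bell_index"
  shows "bell_dof x1 h d (p + (\<Sum>m\<in>added_index. (\<lambda>z. k m * bell_function x1 h m z))) =
    bell_dof x1 h d p + (if d \<in> added_index then k d else 0)"
proof -
  have Q: "(\<lambda>z. k m * bell_function x1 h m z) \<in> Q_space 5" for m
    using bell_function(1)[OF assms(1), of x1 m] unfolding Q_space_def by (rule fun_space.span_scale)
  then have "(\<Sum>m\<in>added_index. (\<lambda>z. k m * bell_function x1 h m z)) \<in> Q_space 5"
    unfolding Q_space_def by (rule fun_space.span_sum)
  then have "bell_dof x1 h d (p + (\<Sum>m\<in>added_index. (\<lambda>z. k m * bell_function x1 h m z))) =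
    bell_dof x1 h d p + (\<Sum>m\<in>added_index. k m * (if d = m then 1 else 0))"
    using assms P_space_5_subset_Q_space_5 Q
    by (simp add: bell_dof_add bell_dof_sum bell_dof_scale bell_function subset_iff)
  then show ?thesis
    using interior_added_index(3) by (simp add: if_distrib[of "(*) _"] cong: if_cong)
qed

text \<open>
  Both halves use that the functionals outside \<open>added_index\<close> see only the \<open>P\<^sub>5\<close> part. They determine
  this part, and then each functional of an added function reads off its coefficient.
\<close>
lemma V5_unisolvent:
  assumes "h \<noteq> 0"
  shows "\<exists>!p. p \<in> V5 x1 h \<and> (\<forall>d\<in>bell_index - interior_index. bell_dof x1 h d p = y d)"
proof (rule ex_ex1I)
  let ?B = "\<lambda>k. \<Sum>m\<in>added_index. (\<lambda>z. k m * bell_function x1 h m z)"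
  let ?K = "bell_index - interior_index - added_index"
  obtain p where p: "p \<in> P_space 5" "\<forall>d\<in>?K. bell_dof x1 h d p = y d"
    using P5_interpolation_exists[OF assms] by blast
  define k where "k d = y d - bell_dof x1 h d p" for d
  have "p + ?B k \<in> V5 x1 h"
    unfolding V5_eq using p(1) by blast
  moreover have "bell_dof x1 h d (p + ?B k) = y d" if "d \<in> bell_index - interior_index" for d
    using that p by (simp add: bell_dof_V5[OF assms p(1)] k_def)
  ultimately show "\<exists>p. p \<in> V5 x1 h \<and> (\<forall>d\<in>bell_index - interior_index. bell_dof x1 h d p = y d)"
    by blast
next
  fix v w
  let ?B = "\<lambda>k. \<Sum>m\<in>added_index. (\<lambda>z. k m * bell_function x1 h m z)"
  assume v: "v \<in> V5 x1 h \<and> (\<forall>d\<in>bell_index - interior_index. bell_dof x1 h d v = y d)"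
    and w: "w \<in> V5 x1 h \<and> (\<forall>d\<in>bell_index - interior_index. bell_dof x1 h d w = y d)"
  obtain p k where vp: "v = p + ?B k" "p \<in> P_space 5"
    using v unfolding V5_eq by blast
  obtain q l where wq: "w = q + ?B l" "q \<in> P_space 5"
    using w unfolding V5_eq by blast
  have eq: "bell_dof x1 h d p + (if d \<in> added_index then k d else 0) =
      bell_dof x1 h d q + (if d \<in> added_index then l d else 0)" if "d \<in> bell_index - interior_index" for d
  proof -
    have "bell_dof x1 h d v = bell_dof x1 h d w"
      using v w that by simp
    moreover have "d \<in> bell_index"
      using that by blast
    ultimately show ?thesis
      by (simp only: vp(1) wq(1) bell_dof_V5[OF assms vp(2)] bell_dof_V5[OF assms wq(2)])
  qed
  have "p - q = 0"
  proof (rule P5_interpolation_unique[OF assms])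
    show "p - q \<in> P_space 5"
      using vp(2) wq(2) unfolding P_space_def by (rule fun_space.span_diff)
    fix d
    assume d: "d \<in> bell_index - interior_index - added_index"
    have "p = (p - q) + q"
      by simp
    then have "bell_dof x1 h d p = bell_dof x1 h d (p - q) + bell_dof x1 h d q"
      using bell_dof_add[OF assms, of "p - q" q] \<open>p - q \<in> P_space 5\<close> wq(2) P_space_5_subset_Q_space_5
      by (metis subsetD)
    with eq[of d] d show "bell_dof x1 h d (p - q) = 0"
      by simp
  qed
  then have "p = q"
    by simp
  moreover have "k m = l m" if "m \<in> added_index" for m
    using eq[of m] that interior_added_index(2) \<open>p = q\<close> by auto
  then have "?B k = ?B l"
    by (intro sum.cong) auto
  ultimately show "v = w"
    using vp wq by simp
qed

text \<open>
  The Bell degrees of freedom without the four interior values, in the order of \<open>V5_dofs\<close>.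
\<close>
definition V5_index :: "(nat \<times> nat \<times> nat) list" where
  "V5_index =
    [(1, 0, 0), (1, 3, 0), (1, 3, 3), (1, 0, 3),
     (2, 0, 0), (2, 1, 0), (2, 1, 2), (2, 0, 2),
     (3, 0, 0), (3, 2, 0), (3, 2, 1), (3, 0, 1),
     (4, 0, 0), (4, 1, 0), (4, 1, 1), (4, 0, 1),
     (1, 2, 0), (1, 1, 0), (1, 3, 2), (1, 3, 1),
     (1, 2, 3), (1, 1, 3), (1, 0, 2), (1, 0, 1),
     (3, 1, 1), (3, 1, 0), (2, 1, 1), (2, 0, 1)]"

lemma V5_index: "length V5_index = 28" "distinct V5_index" "set V5_index = bell_index - interior_index"
proof -
  show "length V5_index = 28" "distinct V5_index"
    by (simp_all add: V5_index_def)
  show "set V5_index = bell_index - interior_index"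
    by code_simp
qed

lemma bell_dof_at_node:
  "z = x1 + (h / 3) *\<^sub>R (real i, real j) \<Longrightarrow> (\<lambda>p. p z) = bell_dof x1 h (1, i, j)"
  "z = x1 + h *\<^sub>R (real i, real j / 2) \<Longrightarrow> (\<lambda>p. d_x p z) = bell_dof x1 h (2, i, j)"
  "z = x1 + h *\<^sub>R (real i / 2, real j) \<Longrightarrow> (\<lambda>p. d_y p z) = bell_dof x1 h (3, i, j)"
  "z = x1 + h *\<^sub>R (real i, real j) \<Longrightarrow> (\<lambda>p. d_xy p z) = bell_dof x1 h (4, i, j)"
  by (simp_all add: bell_dof_def fun_eq_iff)

lemma V5_dofs_eq:
  assumes "x2 = x1 + h *\<^sub>R (1, 0)" "x3 = x1 + h *\<^sub>R (1, 1)" "x4 = x1 + h *\<^sub>R (0, 1)"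
  shows "V5_dofs x1 x2 x3 x4 = map (bell_dof x1 h) V5_index"
  unfolding V5_dofs_def V5_index_def list.map list.inject assms
  by (intro conjI refl bell_dof_at_node; simp add: prod_eq_iff field_simps)

lemma ex_map_eq:
  assumes "distinct xs" "length ys = length xs"
  obtains f where "map f xs = ys"
proof
  show "map (the \<circ> map_of (zip xs ys)) xs = ys"
    using assms by (intro nth_equalityI) (auto simp: map_of_zip_nth)
qed

theorem lemma3p1:
  fixes h :: real and x1 x2 x3 x4 :: "real \<times> real"
  assumes "h > 0"
    and "x2 = x1 + h *\<^sub>R (1, 0)"
    and "x3 = x1 + h *\<^sub>R (1, 1)"
    and "x4 = x1 + h *\<^sub>R (0, 1)"
  shows "\<forall>c :: real list. length c = 28 \<longrightarrow>
    (\<exists>!p. p \<in> V5 x1 h \<and> map (\<lambda>\<phi>. \<phi> p) (V5_dofs x1 x2 x3 x4) = c)"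
proof (intro allI impI)
  fix c :: "real list"
  assume "length c = 28"
  then obtain y where y: "c = map y V5_index"
    using ex_map_eq[of V5_index c] V5_index by metis
  have "map (\<lambda>\<phi>. \<phi> p) (V5_dofs x1 x2 x3 x4) = c \<longleftrightarrow>
      (\<forall>d\<in>bell_index - interior_index. bell_dof x1 h d p = y d)" for p
    unfolding V5_dofs_eq[OF assms(2-4)] y using V5_index(3) by auto
  then show "\<exists>!p. p \<in> V5 x1 h \<and> map (\<lambda>\<phi>. \<phi> p) (V5_dofs x1 x2 x3 x4) = c"
    using V5_unisolvent[of h x1 y] assms(1) by simp
qed

end
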